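(* Let $\lambda=(2^r,1^s)\vdash n$ with $r,s\ge0$, and let $F_\lambda(q)$ be the number of $n\times n$ upper-triangular nilpotent matrices over $\mathbb{F}_q$ of Jordan type $\lambda$. Then $$F_{(2^r,1^s)}(q)=(q-1)^rq^{\binom r2}\sum_{\pi\in\mathcal{D}(r+s,r)}q^{\mathrm{coarea}(\pi)}\prod_{i=1}^r\left[\rho_i(\pi)\right]_q.$$
   Context: Upper-triangular nilpotent matrices are the strictly upper-triangular ones; $q$ is a prime power. A nilpotent $n\times n$ matrix over $\mathbb{F}_q$ has Jordan type $\lambda=(\lambda_1\ge\cdots\ge\lambda_m>0)\vdash n$ if it is similar to $J_{\lambda_1}\oplus\cdots\oplus J_{\lambda_m}$, where $J_i$ is the $i\times i$ Jordan block with eigenvalue $0$. The partition $(2^r,1^s)$ has $r$ parts equal to $2$ and $s$ parts equal to $1$, so $n=2r+s$. $\mathcal{D}(a,b)$ is the set of Dyck paths from $(0,0)$ to $(a,b)$, i.e. lattice paths using steps $(1,0)$ and $(0,1)$ which do not rise above the line $y=x$. $\mathrm{coarea}(\pi)$ is the number of whole unit squares lying between $\pi$ and the $x$-axis (equivalently, the sum of the heights of the horizontal steps of $\pi$). For $\pi\in\mathcal{D}(a,b)$ and $1\le i\le b$, $\rho_i(\pi)$ is the number of whole unit squares in the $i$th row (the strip $i-1\le y\le i$) lying between $\pi$ and the line $y=x+1$; explicitly, if the vertical step of $\pi$ from height $i-1$ to height $i$ is at $x$-coordinate $x_i$, then $\rho_i(\pi)=x_i-(i-1)\ge1$. For example,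 the path visiting $(0,0),(2,0),(2,1),(3,1),(3,3),(4,3),(4,4),(6,4)$ has coarea $12$ and $(\rho_1,\rho_2,\rho_3,\rho_4)=(2,2,1,1)$. For $m\ge1$, $[m]_q=1+q+\cdots+q^{m-1}$. *)

theory Defs
  imports "HOL-Library.Cardinality" "Jordan_Normal_Form.Jordan_Normal_Form"
begin

section \<open>Upper-triangular nilpotent matrices of given Jordan type\<close>

definition nilpotent_mat :: "'a :: semiring_1 mat \<Rightarrow> bool" where
  "nilpotent_mat A \<longleftrightarrow> (\<exists>k. A ^\<^sub>m k = 0\<^sub>m (dim_row A) (dim_row A))"

definition has_jordan_type :: "'a :: semiring_1 mat \<Rightarrow> nat list \<Rightarrow> bool" where
  "has_jordan_type A lam \<longleftrightarrow> jordan_nf A (map (\<lambda>k. (k, 0)) lam)"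

definition ut_nilpotent_mats :: "nat \<Rightarrow> 'a :: semiring_1 mat set" where
  "ut_nilpotent_mats n = {A \<in> carrier_mat n n. upper_triangular A \<and> nilpotent_mat A}"

text \<open>The type argument is the finite field; a partition is given by its list of parts, so the
  matrices have size \<open>sum_list lam\<close>.\<close>

definition F_count :: "'a :: {field, finite} itself \<Rightarrow> nat list \<Rightarrow> nat" where
  "F_count _ lam =
     card {A :: 'a mat. A \<in> ut_nilpotent_mats (sum_list lam) \<and> has_jordan_type A lam}"

lemma finite_carrier_mat: "finite (carrier_mat m n :: 'a :: finite mat set)"
proof -
  let ?D = "{0..<m} \<times> {0..<n}"
  have "carrier_mat m n \<subseteq> mat m n ` (?D \<rightarrow>\<^sub>E (UNIV :: 'a set))"
  proof
    fix A :: "'a mat" assume A: "A \<in> carrier_mat m n"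
    have "A = mat m n (restrict (\<lambda>ij. A $$ ij) ?D)"
      using A by (intro eq_matI) auto
    then show "A \<in> mat m n ` (?D \<rightarrow>\<^sub>E UNIV)"
      by (rule image_eqI[where x = "restrict (\<lambda>ij. A $$ ij) ?D"]) (simp add: PiE_iff)
  qed
  moreover have "finite (?D \<rightarrow>\<^sub>E (UNIV :: 'a set))"
    by (rule finite_PiE) simp_all
  ultimately show ?thesis
    using finite_subset finite_imageI by metis
qed

lemma upper_triangular_pow_diag:
  fixes A :: "'a :: semiring_1 mat"
  assumes A: "A \<in> carrier_mat n n" and ut: "upper_triangular A"
  shows "upper_triangular (A ^\<^sub>m k) \<and> (\<forall>i<n. (A ^\<^sub>m k) $$ (i,i) = (A $$ (i,i)) ^ k)"
proof (induction k)
  case 0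
  then show ?case using A by (simp add: upper_triangular_def)
next
  case (Suc k)
  let ?B = "A ^\<^sub>m k"
  have B: "?B \<in> carrier_mat n n" using A by simp
  have e: "(?B * A) $$ (i,j) = (\<Sum>l\<in>{0..<n}. ?B $$ (i,l) * A $$ (l,j))" if "i < n" "j < n" for i j
    using that A B by (simp add: scalar_prod_def)
  have z: "?B $$ (i,l) = 0" if "l < i" "i < n" for i l
    using upper_triangularD[of ?B l i] Suc.IH carrier_matD(1)[OF B] that by simp
  have z': "A $$ (l,j) = 0" if "j < l" "l < n" for j l
    using upper_triangularD[OF ut, of j l] carrier_matD(1)[OF A] that by simp
  have "(?B * A) $$ (i,j) = 0" if "i < n" "j < i" for i j
  proof -
    have "?B $$ (i,l) * A $$ (l,j) = 0" if "l < n" for l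
    proof (cases "l < i")
      case True
      then show ?thesis using z[of l i] that \<open>i < n\<close> by simp
    next
      case False
      then show ?thesis using z'[of j l] that \<open>j < i\<close> by simp
    qed
    then show ?thesis using e[of i j] that by simp
  qed
  moreover have "(?B * A) $$ (i,i) = (A $$ (i,i)) ^ Suc k" if "i < n" for i
  proof -
    have "?B $$ (i,l) * A $$ (l,i) = (if l = i then ?B $$ (i,i) * A $$ (i,i) else 0)" if "l < n" for l
      using z[of l i] z'[of i l] that \<open>i < n\<close> by (cases l i rule: linorder_cases) simp_all
    then have "(\<Sum>l\<in>{0..<n}. ?B $$ (i,l) * A $$ (l,i)) =
        (\<Sum>l\<in>{0..<n}. if l = i then ?B $$ (i,i) * A $$ (i,i) else 0)"
      by (intro sum.cong) auto
    also have "\<dots> = ?B $$ (i,i) * A $$ (i,i)"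
      using that by (subst sum.delta) auto
    finally show ?thesis
      using Suc.IH that by (simp only: e[OF that that] power_Suc2)
  qed
  moreover have "?B * A \<in> carrier_mat n n" by (rule mult_carrier_mat[OF B A])
  ultimately show ?case using carrier_matD(1)[OF A] unfolding upper_triangular_def by simp
qed

lemma ut_nilpotent_imp_strict:
  fixes A :: "'a :: semiring_1_no_zero_divisors mat"
  assumes "A \<in> ut_nilpotent_mats n" "i < n" "j \<le> i"
  shows "A $$ (i,j) = 0"
proof (cases "j = i")
  case False
  moreover have "dim_row A = n" "upper_triangular A"
    using assms(1) by (auto simp: ut_nilpotent_mats_def)
  ultimately show ?thesis using assms(2,3) upper_triangularD[of A j i] by simp
next
  case True
  have A: "A \<in> carrier_mat n n" "upper_triangular A" and "nilpotent_mat A"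
    using assms by (auto simp: ut_nilpotent_mats_def)
  then obtain k where "A ^\<^sub>m k = 0\<^sub>m n n" by (auto simp: nilpotent_mat_def)
  then have "(A $$ (i,i)) ^ k = 0"
    using upper_triangular_pow_diag[OF A, of k] assms(2) by (metis index_zero_mat(1))
  then show ?thesis using True power_not_zero by blast
qed

section \<open>Dyck paths\<close>

datatype step = East | North

text \<open>A lattice path from the origin is its list of steps; \<open>(xpos p k, ypos p k)\<close> is the point
  reached after \<open>k\<close> steps.\<close>

definition xpos :: "step list \<Rightarrow> nat \<Rightarrow> nat" where
  "xpos p k = count_list (take k p) East"

definition ypos :: "step list \<Rightarrow> nat \<Rightarrow> nat" where
  "ypos p k = count_list (take k p) North"

definition dyck :: "nat \<Rightarrow> nat \<Rightarrow> step list set" where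
  "dyck a b = {p. xpos p (length p) = a \<and> ypos p (length p) = b \<and>
                  (\<forall>k\<le>length p. ypos p k \<le> xpos p k)}"

text \<open>Sum of the heights of the horizontal steps.\<close>

definition coarea :: "step list \<Rightarrow> nat" where
  "coarea p = (\<Sum>k | k < length p \<and> p ! k = East. ypos p k)"

text \<open>The \<open>x\<close>-coordinate of the vertical step from height \<open>i - 1\<close> to height \<open>i\<close>, for
  \<open>1 \<le> i \<le> b\<close> on a path ending at height \<open>b\<close>.\<close>

definition north_x :: "step list \<Rightarrow> nat \<Rightarrow> nat" where
  "north_x p i = xpos p (THE k. k < length p \<and> p ! k = North \<and> ypos p k = i - 1)"

text \<open>Since a Dyck path stays weakly below the diagonal, \<open>north_x p i \<ge> i\<close>, so the subtraction
  does not truncate.\<close>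

definition rho :: "step list \<Rightarrow> nat \<Rightarrow> nat" where
  "rho p i = north_x p i - (i - 1)"

definition q_number :: "'a :: comm_semiring_1 \<Rightarrow> nat \<Rightarrow> 'a" where
  "q_number q m = (\<Sum>j<m. q ^ j)"

lemma finite_dyck: "finite (dyck a b)"
proof -
  have len: "length p = count_list p East + count_list p North" for p
  proof (induction p)
    case (Cons s p)
    then show ?case by (cases s) auto
  qed simp
  have U: "(UNIV :: step set) = {East, North}"
    using step.exhaust by auto
  have "dyck a b \<subseteq> {p. set p \<subseteq> UNIV \<and> length p = a + b}"
    using len by (auto simp: dyck_def xpos_def ypos_def)
  then show ?thesis
    by (rule finite_subset) (intro finite_lists_length_eq, simp add: U)
qed

text \<open>The path through \<open>(0,0), (2,0), (2,1), (3,1), (3,3), (4,3), (4,4), (6,4)\<close>.\<close>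

lemma example_path:
  defines "p \<equiv> [East, East, North, East, North, North, East, North, East, East]"
  shows "p \<in> dyck 6 4" "coarea p = 12" "map (rho p) [1, 2, 3, 4] = [2, 2, 1, 1]"
proof -
  have len: "length p = 10" by (simp add: p_def)
  have lt: "(k < 10) = (k \<in> {0,1,2,3,4,5,6,7,8,9})" for k :: nat by simp presburger
  have le: "(k \<le> 10) = (k \<in> {0,1,2,3,4,5,6,7,8,9,10})" for k :: nat by simp presburger
  show "p \<in> dyck 6 4"
    unfolding dyck_def mem_Collect_eq len le
    by (simp add: p_def xpos_def ypos_def)
  have "{k. k < length p \<and> p ! k = East} = {0,1,3,6,8,9}"
    unfolding len lt by (auto simp: p_def)
  then show "coarea p = 12" by (simp add: coarea_def ypos_def p_def)
  have the: "(THE k. k < length p \<and> p ! k = North \<and> ypos p k = j) = k"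
    if "(j, k) \<in> {(0,2), (1,4), (2,5), (3,7)}" for j k
    using that unfolding len lt
    by (intro the_equality) (auto simp: p_def ypos_def)
  show "map (rho p) [1, 2, 3, 4] = [2, 2, 1, 1]"
    using the[of 0 2] the[of 1 4] the[of 2 5] the[of 3 7]
    by (simp add: rho_def north_x_def) (simp add: xpos_def p_def)
qed

end

theory Submission
  imports Defs "Jordan_Normal_Form.Jordan_Normal_Form_Existence" "Jordan_Normal_Form.Matrix_Kernel"
begin

text \<open>
  A strictly upper-triangular matrix has Jordan type \<open>(2\<^sup>r, 1\<^sup>s)\<close> iff it squares to zero and its
  range has \<open>q\<^sup>r\<close> elements. Let \<open>B\<close> be obtained from such an \<open>n + 1\<close> square matrix by deleting the
  last column and row, and let \<open>v\<close> be the deleted column. Squaring to zero means that \<open>B\<close> squares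
  to zero and \<open>v\<close> lies in the kernel of \<open>B\<close>, and the rank grows by one iff \<open>v\<close> is not in the range
  of \<open>B\<close>. Counting the possible \<open>v\<close> gives
  \<open>N(n + 1, r + 1) = q\<^bsup>r + 1\<^esup> N(n, r + 1) + (q\<^bsup>n - r\<^esup> - q\<^sup>r) N(n, r)\<close>.
  For \<open>n + 1 = 2 (r + 1) + s\<close> the last coefficient is \<open>q\<^sup>r (q - 1) [s + 1]\<close>, so after division by
  \<open>(q - 1)\<^sup>r\<close> and the power of \<open>q\<close> in front of the sum this is the recurrence obtained by removing
  the last step of a Dyck path: a horizontal step at height \<open>r + 1\<close> contributes \<open>q\<^bsup>r + 1\<^esup>\<close>, a
  vertical one \<open>[s + 1]\<close>.
\<close>

subsection \<open>The last step of a Dyck path\<close>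

lemma count_step_eq_length: "count_list p East + count_list p North = length p"
proof (induction p)
  case (Cons x p)
  then show ?case by (cases x) auto
qed simp

lemma pos_snoc:
  assumes "k \<le> length p"
  shows "xpos (p @ [x]) k = xpos p k" "ypos (p @ [x]) k = ypos p k"
  using assms by (simp_all add: xpos_def ypos_def)

text \<open>The only new lattice point lies east of the old endpoint, so the diagonal condition
  there follows from the one at the old endpoint.\<close>

lemma dyck_snoc_East: "p @ [East] \<in> dyck a b \<longleftrightarrow> (\<exists>a'. a = Suc a' \<and> p \<in> dyck a' b)"
proof -
  have *: "(\<forall>k\<le>length (p @ [East]). ypos (p @ [East]) k \<le> xpos (p @ [East]) k) \<longleftrightarrow>
    (\<forall>k\<le>length p. ypos p k \<le> xpos p k)"
    by (auto simp: le_Suc_eq pos_snoc) (auto simp: xpos_def ypos_def dest: spec[of _ "length p"])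
  show ?thesis
    unfolding dyck_def mem_Collect_eq * by (auto simp: xpos_def ypos_def)
qed

text \<open>The new endpoint imposes a genuine condition: the old one must lie strictly below the
  diagonal, whence \<open>b' < a\<close>.\<close>

lemma dyck_snoc_North:
  "p @ [North] \<in> dyck a b \<longleftrightarrow> (\<exists>b'. b = Suc b' \<and> p \<in> dyck a b' \<and> b' < a)"
proof -
  have *: "(\<forall>k\<le>length (p @ [North]). ypos (p @ [North]) k \<le> xpos (p @ [North]) k) \<longleftrightarrow>
    (\<forall>k\<le>length p. ypos p k \<le> xpos p k) \<and> count_list p North < count_list p East"
    by (auto simp: le_Suc_eq pos_snoc)
       (auto simp: xpos_def ypos_def Suc_le_eq dest: spec[of _ "Suc (length p)"])
  show ?thesis
    unfolding dyck_def mem_Collect_eq * by (auto simp: xpos_def ypos_def)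
qed

lemma dyck_0_0: "dyck 0 0 = {[]}"
proof -
  have "p = []" if "p \<in> dyck 0 0" for p
    using that count_step_eq_length[of p] by (simp add: dyck_def xpos_def ypos_def)
  then show ?thesis by (auto simp: dyck_def xpos_def ypos_def)
qed

lemma dyck_eq_empty: "a < b \<Longrightarrow> dyck a b = {}"
  by (force simp: dyck_def)

lemma dyck_Suc_0: "dyck (Suc a) 0 = (\<lambda>p. p @ [East]) ` dyck a 0"
proof (rule Set.set_eqI)
  fix p show "p \<in> dyck (Suc a) 0 \<longleftrightarrow> p \<in> (\<lambda>p. p @ [East]) ` dyck a 0"
  proof (cases p rule: rev_cases)
    case Nil
    then show ?thesis by (auto simp: dyck_def xpos_def)
  next
    case (snoc p' x)
    then show ?thesis by (cases x) (auto simp: dyck_snoc_East dyck_snoc_North)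
  qed
qed

text \<open>The hypothesis amounts to \<open>b < Suc a\<close>, the condition that allows a final
  North step. For \<open>a = b\<close> the first image is empty.\<close>

lemma dyck_Suc_Suc:
  assumes "b \<le> a"
  shows "dyck (Suc a) (Suc b) =
    (\<lambda>p. p @ [East]) ` dyck a (Suc b) \<union> (\<lambda>p. p @ [North]) ` dyck (Suc a) b"
proof (rule Set.set_eqI)
  fix p
  show "p \<in> dyck (Suc a) (Suc b) \<longleftrightarrow>
    p \<in> (\<lambda>p. p @ [East]) ` dyck a (Suc b) \<union> (\<lambda>p. p @ [North]) ` dyck (Suc a) b"
  proof (cases p rule: rev_cases)
    case Nil
    then show ?thesis by (auto simp: dyck_def xpos_def)
  next
    case (snoc p' x)
    then show ?thesis
      using assms by (cases x) (auto simp: dyck_snoc_East dyck_snoc_North)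
  qed
qed

section \<open>Coarea and row lengths when a step is appended\<close>

lemma coarea_snoc:
  "coarea (p @ [East]) = coarea p + count_list p North"
  "coarea (p @ [North]) = coarea p"
proof -
  have *: "{k. k < length (p @ [x]) \<and> (p @ [x]) ! k = East} =
    {k. k < length p \<and> p ! k = East} \<union> (if x = East then {length p} else {})" for x
    by (auto simp: less_Suc_eq nth_append)
  have **: "(\<Sum>k | k < length p \<and> p ! k = East. ypos (p @ [x]) k) = coarea p" for x
    unfolding coarea_def by (intro sum.cong) (auto simp: pos_snoc)
  show "coarea (p @ [East]) = coarea p + count_list p North"
    unfolding coarea_def[of "p @ [East]"] *
    by (subst sum.union_disjoint) (auto simp: **, simp add: ypos_def)
  show "coarea (p @ [North]) = coarea p"
    unfolding coarea_def[of "p @ [North]"] * by (simp add: **)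
qed

text \<open>Splits the predicate under \<open>THE\<close> in \<open>north_x\<close>, so that
  uniqueness and value of the description carry over when a step is appended.\<close>

lemma north_step_snoc:
  "k < length (p @ [x]) \<and> (p @ [x]) ! k = North \<and> ypos (p @ [x]) k = i \<longleftrightarrow>
    k < length p \<and> p ! k = North \<and> ypos p k = i \<or>
    k = length p \<and> x = North \<and> count_list p North = i"
  by (auto simp: less_Suc_eq nth_append pos_snoc) (auto simp: ypos_def)

lemma ypos_less_count: "k < length p \<Longrightarrow> p ! k = North \<Longrightarrow> ypos p k < count_list p North"
proof (induction p rule: rev_induct)
  case (snoc x p)
  then show ?case
    by (auto simp: less_Suc_eq nth_append pos_snoc) (auto simp: ypos_def)
qed simp

text \<open>Gives meaning to the description in \<open>north_x\<close>. In the induction, an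
  appended North step leaves from height \<open>count_list p North\<close>, whereas all earlier ones
  leave from smaller heights.\<close>

lemma ex1_north_step:
  "i < count_list p North \<Longrightarrow> \<exists>!k. k < length p \<and> p ! k = North \<and> ypos p k = i"
proof (induction p rule: rev_induct)
  case (snoc x p)
  show ?case
  proof (cases "i < count_list p North")
    case True
    then show ?thesis using snoc.IH by (simp only: north_step_snoc) auto
  next
    case False
    then have x: "x = North" "count_list p North = i" using snoc.prems by (auto split: if_splits)
    then have "\<not> (k < length p \<and> p ! k = North \<and> ypos p k = i)" for k
      using ypos_less_count by fastforce
    with x show ?thesis by (simp only: north_step_snoc) auto
  qed
qed simp

lemma north_x_snoc:
  assumes "0 < i" "i \<le> count_list p North"
  shows "north_x (p @ [x]) i = north_x p i"
proof -
  have ex: "\<exists>!k. k < length p \<and> p ! k = North \<and> ypos p k = i - 1"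
    using assms by (intro ex1_north_step) auto
  \<comment> \<open>Since \<open>i - 1 < count_list p North\<close>, an appended North step would
    leave from a different height, so both predicates agree.\<close>
  have "(THE k. k < length (p @ [x]) \<and> (p @ [x]) ! k = North \<and> ypos (p @ [x]) k = i - 1) =
    (THE k. k < length p \<and> p ! k = North \<and> ypos p k = i - 1)"
    unfolding north_step_snoc using assms by (intro arg_cong[of _ _ The]) auto
  moreover have "(THE k. k < length p \<and> p ! k = North \<and> ypos p k = i - 1) < length p"
    using theI'[OF ex] by simp
  ultimately show ?thesis by (simp only: north_x_def pos_snoc(1) less_imp_le)
qed

lemma north_x_snoc_North: "north_x (p @ [North]) (Suc (count_list p North)) = count_list p East"
proof -
  have "(THE k. k < length (p @ [North]) \<and> (p @ [North]) ! k = North \<and>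
    ypos (p @ [North]) k = Suc (count_list p North) - 1) = length p"
    by (intro the1_equality ex1_north_step) (auto simp: ypos_def)
  then show ?thesis by (simp only: north_x_def) (simp add: xpos_def)
qed

lemma q_minus_1_times_q_number: "(q - 1) * q_number q m = q ^ m - (1 :: int)"
  unfolding q_number_def by (induction m) (auto simp: algebra_simps)

section \<open>The weighted sum over Dyck paths and its recurrence\<close>

definition dyck_sum :: "int \<Rightarrow> nat \<Rightarrow> nat \<Rightarrow> int" where
  "dyck_sum q a b = (\<Sum>p\<in>dyck a b. q ^ coarea p * (\<Prod>i=1..b. q_number q (rho p i)))"

lemma dyck_sum_eq_0: "a < b \<Longrightarrow> dyck_sum q a b = 0"
  by (simp add: dyck_sum_def dyck_eq_empty)

lemma dyck_sum_0: "dyck_sum q a 0 = 1"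
proof (induction a)
  case 0
  then show ?case by (simp add: dyck_sum_def dyck_0_0 coarea_def)
next
  case (Suc a)
  have "count_list p North = 0" if "p \<in> dyck a 0" for p
    using that by (simp add: dyck_def ypos_def)
  then have "dyck_sum q (Suc a) 0 = dyck_sum q a 0"
    unfolding dyck_sum_def dyck_Suc_0
    by (subst sum.reindex) (auto simp: inj_on_def coarea_snoc intro!: sum.cong)
  with Suc show ?case by simp
qed

text \<open>Paths are sorted by their last step. Either kind leaves the earlier row lengths
  unchanged; a final East step runs at height \<open>Suc b\<close> and multiplies the weight by
  \<open>q ^ Suc b\<close>, a final North step only adds a row.\<close>

lemma dyck_sum_Suc_Suc:
  assumes "b \<le> a"
  shows "dyck_sum q (Suc a) (Suc b) =
    q ^ Suc b * dyck_sum q a (Suc b) + q_number q (Suc a - b) * dyck_sum q (Suc a) b"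
proof -
  let ?w = "\<lambda>b p. q ^ coarea p * (\<Prod>i=1..b. q_number q (rho p i))"
  have cnt: "count_list p East = m" "count_list p North = n" if "p \<in> dyck m n" for p m n
    using that by (auto simp: dyck_def xpos_def ypos_def)
  have E: "?w (Suc b) (p @ [East]) = q ^ Suc b * ?w (Suc b) p" if "p \<in> dyck a (Suc b)" for p
  proof -
    have "(\<Prod>i=1..Suc b. q_number q (rho (p @ [East]) i)) = (\<Prod>i=1..Suc b. q_number q (rho p i))"
      by (intro prod.cong) (auto simp: rho_def north_x_snoc cnt[OF that])
    then show ?thesis by (simp add: coarea_snoc cnt[OF that] power_add)
  qed
  have N: "?w (Suc b) (p @ [North]) = q_number q (Suc a - b) * ?w b p" if "p \<in> dyck (Suc a) b" for p
  proof -
    have "(\<Prod>i=1..b. q_number q (rho (p @ [North]) i)) = (\<Prod>i=1..b. q_number q (rho p i))"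
      by (intro prod.cong) (auto simp: rho_def north_x_snoc cnt[OF that])
    \<comment> \<open>The final North step stands at \<open>x = Suc a\<close> and leaves from height
      \<open>b\<close>.\<close>
    moreover have "rho (p @ [North]) (Suc b) = Suc a - b"
      using north_x_snoc_North[of p] by (simp add: rho_def cnt[OF that])
    ultimately show ?thesis by (simp add: coarea_snoc)
  qed
  have "dyck_sum q (Suc a) (Suc b) = (\<Sum>p\<in>dyck a (Suc b). ?w (Suc b) (p @ [East])) +
    (\<Sum>p\<in>dyck (Suc a) b. ?w (Suc b) (p @ [North]))"
    unfolding dyck_sum_def dyck_Suc_Suc[OF assms]
    by (subst sum.union_disjoint)
       (auto simp: finite_dyck inj_on_def sum.reindex simp del: prod.cl_ivl_Suc)
  also have "\<dots> = q ^ Suc b * dyck_sum q a (Suc b) + q_number q (Suc a - b) * dyck_sum q (Suc a) b"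
    by (simp only: dyck_sum_def sum_distrib_left E N cong: sum.cong)
  finally show ?thesis .
qed

subsection \<open>Range and kernel over a finite field\<close>

text \<open>Over a finite field the rank is recorded by the cardinality of this set, which is the
  field size to the power of the rank; counting then replaces dimension arguments.\<close>

definition mat_range :: "'a :: semiring_0 mat \<Rightarrow> 'a vec set" where
  "mat_range A = (\<lambda>v. A *\<^sub>v v) ` carrier_vec (dim_col A)"

lemma bij_betw_vec_of_list: "bij_betw vec_of_list {xs. length xs = n} (carrier_vec n)"
  by (intro bij_betw_byWitness[where f' = list_of_vec])
     (auto simp: vec_list list_vec intro: carrier_vecI)

lemma card_carrier_vec: "card (carrier_vec n :: 'a :: finite vec set) = CARD('a) ^ n"
  using bij_betw_same_card[OF bij_betw_vec_of_list[where ?'a = 'a and n = n]]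
    card_lists_length_eq[of "UNIV :: 'a set" n]
  by simp

lemma finite_carrier_vec: "finite (carrier_vec n :: 'a :: finite vec set)"
  using card_carrier_vec[where ?'a = 'a, of n] by (intro card_ge_0_finite) simp

lemma finite_mat_range: "finite (mat_range (A :: 'a :: {semiring_0, finite} mat))"
  by (simp add: mat_range_def finite_carrier_vec)

text \<open>Rank-nullity in multiplicative form: every nonempty fibre of
  \<open>v \<mapsto> A v\<close> is a translate of the kernel, and the fibres over the range
  partition the whole space.\<close>

lemma card_mat_range_mult_card_mat_kernel:
  fixes A :: "'a :: {field, finite} mat"
  assumes A: "A \<in> carrier_mat m n"
  shows "card (mat_range A) * card (mat_kernel A) = CARD('a) ^ n"
proof -
  let ?V = "carrier_vec n :: 'a vec set"
  have fiber: "card {v \<in> ?V. A *\<^sub>v v = A *\<^sub>v w} = card (mat_kernel A)" if w: "w \<in> ?V" for w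
  proof (rule bij_betw_same_card)
    show "bij_betw (\<lambda>v. v - w) {v \<in> ?V. A *\<^sub>v v = A *\<^sub>v w} (mat_kernel A)"
      using A w by (intro bij_betw_byWitness[where f' = "\<lambda>v. v + w"])
        (auto simp: mat_kernel[OF A] mult_minus_distrib_mat_vec[OF A] mult_add_distrib_mat_vec[OF A])
  qed
  have "card ?V = (\<Sum>y\<in>mat_range A. card {v \<in> ?V. A *\<^sub>v v = y})"
    using sum.image_gen[OF finite_carrier_vec[where ?'a = 'a], of "\<lambda>_. 1 :: nat" n "\<lambda>v. A *\<^sub>v v"] A
    by (simp add: mat_range_def)
  also have "\<dots> = (\<Sum>y\<in>mat_range A. card (mat_kernel A))"
    using A by (intro sum.cong) (auto simp: mat_range_def fiber)
  finally show ?thesis by (simp add: card_carrier_vec)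
qed

lemma mat_range_subset_carrier: "A \<in> carrier_mat m n \<Longrightarrow> mat_range A \<subseteq> carrier_vec m"
  by (auto simp: mat_range_def)

lemma mat_range_subset_mat_kernel:
  assumes A: "A \<in> carrier_mat n n" and sq: "A * A = 0\<^sub>m n n"
  shows "mat_range A \<subseteq> mat_kernel A"
proof
  fix y assume "y \<in> mat_range A"
  then obtain v where v: "v \<in> carrier_vec n" "y = A *\<^sub>v v" using A by (auto simp: mat_range_def)
  have "A *\<^sub>v y = (A * A) *\<^sub>v v" using A v by simp
  then show "y \<in> mat_kernel A" using A v sq by (auto simp: mat_kernel[OF A])
qed

text \<open>For \<open>A = P * B * Q\<close>, multiplication by \<open>P\<close> carries the range
  of \<open>B\<close> onto that of \<open>A\<close>, and \<open>Q\<close> undoes it.\<close>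

lemma card_mat_range_similar:
  assumes "similar_mat A B"
  shows "card (mat_range A) = card (mat_range B)"
proof -
  from similar_matD[OF assms] obtain n P Q where
    c: "A \<in> carrier_mat n n" "B \<in> carrier_mat n n" "P \<in> carrier_mat n n" "Q \<in> carrier_mat n n"
    and PQ: "P * Q = 1\<^sub>m n" and QP: "Q * P = 1\<^sub>m n" and A: "A = P * B * Q" by auto
  have QPv: "Q *\<^sub>v (P *\<^sub>v v) = v" if "v \<in> carrier_vec n" for v
    using assoc_mult_mat_vec[OF c(4,3) that] that by (simp add: QP)
  have Av: "A *\<^sub>v v = P *\<^sub>v (B *\<^sub>v (Q *\<^sub>v v))" if "v \<in> carrier_vec n" for v
    using c that by (simp add: A assoc_mult_mat_vec[of _ n n _ n])
  have "mat_range A = (\<lambda>v. P *\<^sub>v v) ` mat_range B"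
  proof (intro equalityI subsetI)
    fix y assume "y \<in> mat_range A"
    then show "y \<in> (\<lambda>v. P *\<^sub>v v) ` mat_range B"
      using c by (auto simp: mat_range_def Av intro!: imageI)
  next
    fix y assume "y \<in> (\<lambda>v. P *\<^sub>v v) ` mat_range B"
    then obtain v where v: "v \<in> carrier_vec n" "y = P *\<^sub>v (B *\<^sub>v v)"
      using c by (auto simp: mat_range_def)
    then have "y = A *\<^sub>v (P *\<^sub>v v)" "P *\<^sub>v v \<in> carrier_vec n" using c by (auto simp: Av QPv)
    then show "y \<in> mat_range A" using c by (auto simp: mat_range_def)
  qed
  moreover have "inj_on (\<lambda>v. P *\<^sub>v v) (mat_range B)"
    using mat_range_subset_carrier[OF c(2)] QPv
    by (intro inj_on_inverseI[where g = "\<lambda>v. Q *\<^sub>v v"]) blast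
  ultimately show ?thesis by (simp add: card_image)
qed

lemma similar_mat_mult_self_zero:
  assumes "similar_mat A B" "B \<in> carrier_mat n n" "B * B = 0\<^sub>m n n"
  shows "A * A = 0\<^sub>m n n"
proof -
  from assms obtain P Q where w: "similar_mat_wit A B P Q" by (auto simp: similar_mat_def)
  note c = similar_mat_witD2[OF assms(2) similar_mat_wit_sym[OF w]]
  have "A ^\<^sub>m 2 = P * (B ^\<^sub>m 2) * Q" by (rule similar_mat_wit_pow_id[OF w])
  then show ?thesis using c assms by (simp add: numeral_2_eq_2)
qed

text \<open>The blocks act independently on the two halves of a vector, so concatenation identifies
  the product of the two ranges with the range of the whole matrix.\<close>

lemma card_mat_range_block_diag:
  assumes A: "A \<in> carrier_mat n1 m1" and D: "D \<in> carrier_mat n2 m2"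
  shows "card (mat_range (four_block_mat A (0\<^sub>m n1 m2) (0\<^sub>m n2 m1) D)) =
    card (mat_range A) * card (mat_range D)"
proof -
  let ?M = "four_block_mat A (0\<^sub>m n1 m2) (0\<^sub>m n2 m1) D"
  have M: "?M *\<^sub>v (a @\<^sub>v d) = (A *\<^sub>v a) @\<^sub>v (D *\<^sub>v d)"
    if "a \<in> carrier_vec m1" "d \<in> carrier_vec m2" for a d
    using A D that by (subst four_block_mat_mult_vec[OF A _ _ D that]) auto
  have "mat_range ?M = (\<lambda>(y, z). y @\<^sub>v z) ` (mat_range A \<times> mat_range D)"
  proof (intro equalityI subsetI)
    fix w assume "w \<in> mat_range ?M"
    then obtain v where v: "v \<in> carrier_vec (m1 + m2)" "w = ?M *\<^sub>v v"
      using A D by (auto simp: mat_range_def)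
    have "w = (A *\<^sub>v vec_first v m1) @\<^sub>v (D *\<^sub>v vec_last v m2)"
      using v M[of "vec_first v m1" "vec_last v m2"] by simp
    then show "w \<in> (\<lambda>(y, z). y @\<^sub>v z) ` (mat_range A \<times> mat_range D)"
      using A D by (force simp: mat_range_def)
  next
    fix w assume "w \<in> (\<lambda>(y, z). y @\<^sub>v z) ` (mat_range A \<times> mat_range D)"
    then obtain a d where ad: "a \<in> carrier_vec m1" "d \<in> carrier_vec m2"
      "w = (A *\<^sub>v a) @\<^sub>v (D *\<^sub>v d)"
      using A D by (auto simp: mat_range_def)
    then show "w \<in> mat_range ?M"
      using A D M[OF ad(1,2)] unfolding mat_range_def
      by (intro image_eqI[of _ _ "a @\<^sub>v d"]) auto
  qed
  moreover have "inj_on (\<lambda>(y, z). y @\<^sub>v z) (mat_range A \<times> mat_range D)"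
    using mat_range_subset_carrier[OF A] mat_range_subset_carrier[OF D]
    by (auto simp: inj_on_def append_vec_eq[of _ n1] subset_iff)
  ultimately show ?thesis by (simp add: card_image card_cartesian_product)
qed

subsection \<open>Jordan normal forms up to the order of the blocks\<close>

text \<open>The conjugating matrices \<open>?P\<close> and \<open>?Q\<close> are the block
  permutation matrices that exchange the first and the last coordinates.\<close>

lemma similar_block_diag_swap:
  fixes A :: "'a :: ring_1 mat"
  assumes A: "A \<in> carrier_mat n n" and D: "D \<in> carrier_mat m m"
  shows "similar_mat (four_block_mat A (0\<^sub>m n m) (0\<^sub>m m n) D)
    (four_block_mat D (0\<^sub>m m n) (0\<^sub>m n m) A)"
proof (rule similar_matI)
  let ?P = "four_block_mat (0\<^sub>m n m) (1\<^sub>m n) (1\<^sub>m m) (0\<^sub>m m n) :: 'a mat"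
  let ?Q = "four_block_mat (0\<^sub>m m n) (1\<^sub>m m) (1\<^sub>m n) (0\<^sub>m n m) :: 'a mat"
  let ?M = "four_block_mat A (0\<^sub>m n m) (0\<^sub>m m n) D"
  let ?N = "four_block_mat D (0\<^sub>m m n) (0\<^sub>m n m) A"
  have P: "?P \<in> carrier_mat (n + m) (n + m)" and Q: "?Q \<in> carrier_mat (n + m) (n + m)"
    by (simp_all add: carrier_matI)
  show "{?M, ?N, ?P, ?Q} \<subseteq> carrier_mat (n + m) (n + m)"
    using four_block_carrier_mat[OF A D] four_block_carrier_mat[OF D A] P Q
    by (simp add: add.commute[of m n])
  show "?P * ?Q = 1\<^sub>m (n + m)"
    by (subst mult_four_block_mat[of _ n m _ n _ m _ _ n _ m]) auto
  show "?Q * ?P = 1\<^sub>m (n + m)"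
    by (subst mult_four_block_mat[of _ m n _ m _ n _ _ m _ n]) (auto simp: add.commute[of m n])
  have "?P * ?N = four_block_mat (0\<^sub>m n m) A D (0\<^sub>m m n)"
    using A D by (subst mult_four_block_mat[of _ n m _ n _ m _ _ m _ n]) auto
  also have "\<dots> * ?Q = ?M"
    using A D by (subst mult_four_block_mat[of _ n m _ n _ m _ _ n _ m]) auto
  finally show "?M = ?P * ?N * ?Q" by simp
qed

text \<open>The blocks \<open>Xs\<close> are merged into one block, which is swapped with
  \<open>A\<close>; the merged block of \<open>Ys\<close> stays in place.\<close>

lemma similar_diag_block_mat_move:
  fixes A :: "'a :: ring_1 mat"
  assumes "square_mat A" "\<forall>B\<in>set Xs \<union> set Ys. square_mat B"
  shows "similar_mat (diag_block_mat (Xs @ A # Ys)) (diag_block_mat (A # Xs @ Ys))"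
proof -
  let ?D = "diag_block_mat :: 'a mat list \<Rightarrow> 'a mat"
  have sq: "square_mat (?D Xs)" "square_mat (?D Ys)"
    using assms(2) diag_block_mat_square[of Xs] diag_block_mat_square[of Ys] by blast+
  have c: "A \<in> carrier_mat (dim_row A) (dim_row A)"
    "?D Xs \<in> carrier_mat (dim_row (?D Xs)) (dim_row (?D Xs))"
    "?D Ys \<in> carrier_mat (dim_row (?D Ys)) (dim_row (?D Ys))"
    using sq assms(1) by auto
  have "similar_mat (?D (Xs @ [A])) (?D (A # Xs))"
    using similar_block_diag_swap[OF c(2,1)] sq assms(1)
    by (simp add: diag_block_mat_last Let_def)
  moreover have "similar_mat (?D Ys) (?D Ys)" by (rule similar_mat_refl[OF c(3)])
  ultimately have "similar_mat (?D [?D (Xs @ [A]), ?D Ys]) (?D [?D (A # Xs), ?D Ys])"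
    using similar_diag_mat_block_mat[of "[(?D (Xs @ [A]), ?D (A # Xs)), (?D Ys, ?D Ys)]"]
    by auto
  \<comment> \<open>Merged blocks can be split again into the concatenated list.\<close>
  moreover have "?D [?D Us, ?D Vs] = ?D (Us @ Vs)" for Us Vs
    by (simp only: diag_block_mat_append Let_def diag_block_mat.simps(2)[of "?D Us"]
        diag_block_mat_singleton)
  ultimately show ?thesis by (metis append_Cons append_assoc append_Nil)
qed

text \<open>The head of \<open>As\<close> is located in \<open>Bs\<close> and moved to the front
  there; the induction hypothesis rearranges the remaining blocks.\<close>

lemma similar_diag_block_mat_mset:
  fixes As :: "'a :: ring_1 mat list"
  assumes "mset As = mset Bs" "\<forall>A\<in>set As. square_mat A"
  shows "similar_mat (diag_block_mat As) (diag_block_mat Bs)"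
  using assms
proof (induction As arbitrary: Bs)
  case Nil
  then show ?case by (auto intro!: similar_mat_refl[of _ 0])
next
  case (Cons A As)
  then have "A \<in> set Bs" by (metis list.set_intros(1) mset_eq_setD)
  then obtain Xs Ys where Bs: "Bs = Xs @ A # Ys" by (meson split_list)
  with Cons.prems have m: "mset As = mset (Xs @ Ys)" by simp
  then have s: "set As = set (Xs @ Ys)" by (rule mset_eq_setD)
  have "similar_mat (diag_block_mat As) (diag_block_mat (Xs @ Ys))"
    using Cons.IH[OF m] Cons.prems(2) by simp
  moreover have "similar_mat A A" using Cons.prems(2) by (intro similar_mat_refl) auto
  ultimately have "similar_mat (diag_block_mat [A, diag_block_mat As])
      (diag_block_mat [A, diag_block_mat (Xs @ Ys)])"
    using similar_diag_mat_block_mat[of "[(A, A), (diag_block_mat As, diag_block_mat (Xs @ Ys))]"]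
    by auto
  then have "similar_mat (diag_block_mat (A # As)) (diag_block_mat (A # Xs @ Ys))"
    by (simp only: diag_block_mat.simps(2)[of A] diag_block_mat_singleton)
  moreover have "similar_mat (diag_block_mat (Xs @ A # Ys)) (diag_block_mat (A # Xs @ Ys))"
    using Cons.prems(2) s by (intro similar_diag_block_mat_move) auto
  ultimately show ?case
    unfolding Bs by (meson similar_mat_sym similar_mat_trans)
qed

text \<open>\<open>has_jordan_type\<close> prescribes an order of the blocks, whereas a Jordan
  normal form obtained for a given matrix may list them in any order.\<close>

lemma jordan_nf_mset:
  fixes A :: "'a :: ring_1 mat"
  assumes "jordan_nf A xs" "mset xs = mset ys"
  shows "jordan_nf A ys"
proof -
  have "similar_mat (jordan_matrix xs) (jordan_matrix ys)"
    unfolding jordan_matrix_def using assms(2) by (intro similar_diag_block_mat_mset) auto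
  then show ?thesis
    using assms mset_eq_setD[OF assms(2)] similar_mat_trans unfolding jordan_nf_def by metis
qed

section \<open>Range and square of a Jordan matrix\<close>

text \<open>The nilpotent block shifts the coordinates by one position and puts 0 at the end, so its
  range consists of the vectors with last coordinate 0.\<close>

lemma card_mat_range_jordan_block:
  assumes "0 < k"
  shows "card (mat_range (jordan_block k (0 :: 'a :: {field, finite}))) = CARD('a) ^ (k - 1)"
proof -
  let ?J = "jordan_block k (0 :: 'a)"
  have J: "(?J *\<^sub>v v) $ i = (if Suc i < k then v $ Suc i else 0)"
    if "i < k" "v \<in> carrier_vec k" for i v
  proof -
    have "(?J *\<^sub>v v) $ i =
      (\<Sum>j = 0..<k. (if i = j then 0 else if Suc i = j then 1 else 0) * v $ j)"
      using that by (simp add: scalar_prod_def)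
    also have "\<dots> = (\<Sum>j = 0..<k. if Suc i = j then v $ j else 0)"
      by (intro sum.cong) auto
    finally show ?thesis using that by simp
  qed
  have "mat_range ?J = (\<lambda>w. w @\<^sub>v 0\<^sub>v 1) ` carrier_vec (k - 1)"
  proof (intro equalityI subsetI)
    fix y assume "y \<in> mat_range ?J"
    then obtain v where v: "v \<in> carrier_vec k" "y = ?J *\<^sub>v v" by (auto simp: mat_range_def)
    then have "y = vec (k - 1) (\<lambda>i. v $ Suc i) @\<^sub>v 0\<^sub>v 1"
      using assms by (intro eq_vecI) (auto simp: J simp del: index_mult_mat_vec)
    then show "y \<in> (\<lambda>w. w @\<^sub>v 0\<^sub>v 1) ` carrier_vec (k - 1)" by auto
  next
    fix y :: "'a vec" assume "y \<in> (\<lambda>w. w @\<^sub>v 0\<^sub>v 1) ` carrier_vec (k - 1)"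
    then obtain w where w: "w \<in> carrier_vec (k - 1)" "y = w @\<^sub>v 0\<^sub>v 1" by auto
    \<comment> \<open>The preimage is \<open>w\<close> shifted back by one. Its coordinate 0 may
      hold any value, because the block shifts it out.\<close>
    let ?v = "vec k (\<lambda>i. w $ (i - 1))"
    have "y = ?J *\<^sub>v ?v"
      using assms w by (intro eq_vecI) (auto simp: J simp del: index_mult_mat_vec)
    then show "y \<in> mat_range ?J" by (auto simp: mat_range_def)
  qed
  moreover have "inj_on (\<lambda>w. w @\<^sub>v 0\<^sub>v 1) (carrier_vec (k - 1) :: 'a vec set)"
    by (auto simp: inj_on_def append_vec_eq)
  ultimately show ?thesis by (simp add: card_image card_carrier_vec)
qed

lemma card_mat_range_jordan_matrix:
  assumes "0 \<notin> set ks"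
  shows "card (mat_range (jordan_matrix (map (\<lambda>k. (k, 0 :: 'a :: {field, finite})) ks))) =
    CARD('a) ^ (\<Sum>k\<leftarrow>ks. k - 1)"
  using assms
proof (induction ks)
  case Nil
  \<comment> \<open>The empty matrix has one value, the empty vector, which matches exponent
    0.\<close>
  have "mat_range (jordan_matrix [] :: 'a mat) = {0\<^sub>v 0}"
    by (auto simp: mat_range_def jordan_matrix_def intro!: image_eqI[of _ _ "0\<^sub>v 0"])
  then show ?case by simp
next
  case (Cons k ks)
  let ?xs = "map (\<lambda>k. (k, 0 :: 'a)) ks"
  have "card (mat_range (jordan_matrix ((k, 0) # ?xs))) =
    card (mat_range (jordan_block k (0 :: 'a))) * card (mat_range (jordan_matrix ?xs))"
    unfolding jordan_matrix_Cons
    by (rule card_mat_range_block_diag[OF jordan_block_carrier jordan_matrix_carrier])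
  then show ?case using Cons by (simp add: card_mat_range_jordan_block flip: power_add)
qed

lemma diag_block_mat_eq_zeroD:
  assumes "diag_block_mat As = 0\<^sub>m n m" "A \<in> set As"
  shows "A = 0\<^sub>m (dim_row A) (dim_col A)"
  using assms
proof (induction As arbitrary: n m)
  case (Cons B As)
  let ?D = "diag_block_mat As"
  let ?M = "four_block_mat B (0\<^sub>m (dim_row B) (dim_col ?D)) (0\<^sub>m (dim_row ?D) (dim_col B)) ?D"
  have M: "?M = 0\<^sub>m n m" using Cons.prems(1) by (simp add: Let_def)
  then have d: "n = dim_row B + dim_row ?D" "m = dim_col B + dim_col ?D"
    by (metis index_mat_four_block(2) index_zero_mat(2), metis index_mat_four_block(3) index_zero_mat(3))
  have "B = 0\<^sub>m (dim_row B) (dim_col B)"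
  proof (rule eq_matI)
    fix i j assume "i < dim_row (0\<^sub>m (dim_row B) (dim_col B) :: 'a mat)"
      "j < dim_col (0\<^sub>m (dim_row B) (dim_col B) :: 'a mat)"
    then show "B $$ (i, j) = 0\<^sub>m (dim_row B) (dim_col B) $$ (i, j)"
      using arg_cong[OF M, of "\<lambda>M. M $$ (i, j)"] d by simp
  qed auto
  moreover have "?D = 0\<^sub>m (dim_row ?D) (dim_col ?D)"
  proof (rule eq_matI)
    fix i j assume "i < dim_row (0\<^sub>m (dim_row ?D) (dim_col ?D) :: 'a mat)"
      "j < dim_col (0\<^sub>m (dim_row ?D) (dim_col ?D) :: 'a mat)"
    then show "?D $$ (i, j) = 0\<^sub>m (dim_row ?D) (dim_col ?D) $$ (i, j)"
      using arg_cong[OF M, of "\<lambda>M. M $$ (dim_row B + i, dim_col B + j)"] d by simp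
  qed auto
  ultimately show ?case using Cons.IH Cons.prems(2) by auto
qed simp

text \<open>The square has \<open>a ^ 2\<close> at \<open>(0, 0)\<close>; once \<open>a = 0\<close>,
  it has 1 at \<open>(0, 2)\<close> as soon as the block is that large.\<close>

lemma jordan_block_square_eq_zero_iff:
  assumes "0 < k"
  shows "jordan_block k (a :: 'a :: field) ^\<^sub>m 2 = 0\<^sub>m k k \<longleftrightarrow> a = 0 \<and> k \<le> 2"
proof
  assume z: "jordan_block k a ^\<^sub>m 2 = 0\<^sub>m k k"
  have "a = 0"
    using arg_cong[OF z, of "\<lambda>M. M $$ (0, 0)"] assms by (simp add: jordan_block_pow)
  have "k \<le> 2"
  proof (rule ccontr)
    assume "\<not> k \<le> 2"
    then show False
      using arg_cong[OF z, of "\<lambda>M. M $$ (0, 2)"] by (simp add: jordan_block_zero_pow \<open>a = 0\<close>)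
  qed
  with \<open>a = 0\<close> show "a = 0 \<and> k \<le> 2" by simp
next
  assume "a = 0 \<and> k \<le> 2"
  then show "jordan_block k a ^\<^sub>m 2 = 0\<^sub>m k k" by (auto simp: jordan_block_zero_pow intro!: eq_matI)
qed

text \<open>Squares of block diagonal matrices are taken blockwise. An empty block would admit any
  eigenvalue, hence the assumption that excludes size 0.\<close>

lemma jordan_matrix_square_eq_zero_iff:
  fixes xs :: "(nat \<times> 'a :: field) list"
  assumes "0 \<notin> fst ` set xs" and n: "n = sum_list (map fst xs)"
  shows "jordan_matrix xs * jordan_matrix xs = 0\<^sub>m n n \<longleftrightarrow> (\<forall>(k, a)\<in>set xs. a = 0 \<and> k \<le> 2)"
proof -
  have "jordan_matrix xs * jordan_matrix xs = jordan_matrix xs ^\<^sub>m 2"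
    by (simp add: numeral_2_eq_2)
  also have "\<dots> = diag_block_mat (map (\<lambda>(k, a). jordan_block k a ^\<^sub>m 2) xs)"
    by (rule jordan_matrix_pow)
  finally have e: "jordan_matrix xs * jordan_matrix xs = \<dots>" .
  show ?thesis
  proof
    assume "jordan_matrix xs * jordan_matrix xs = 0\<^sub>m n n"
    then have z: "diag_block_mat (map (\<lambda>(k, a). jordan_block k a ^\<^sub>m 2) xs) = 0\<^sub>m n n"
      by (simp add: e)
    have "a = 0 \<and> k \<le> 2" if "(k, a) \<in> set xs" for k a
    proof -
      have "0 < k" using that assms(1) by (metis fst_conv gr0I image_eqI)
      moreover have "jordan_block k a ^\<^sub>m 2 = 0\<^sub>m k k"
      proof -
        have "jordan_block k a ^\<^sub>m 2 \<in> set (map (\<lambda>(k, a). jordan_block k a ^\<^sub>m 2) xs)"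
          using that by force
        from diag_block_mat_eq_zeroD[OF z this] show ?thesis by simp
      qed
      ultimately show ?thesis using jordan_block_square_eq_zero_iff by blast
    qed
    then show "\<forall>(k, a)\<in>set xs. a = 0 \<and> k \<le> 2" by blast
  next
    assume "\<forall>(k, a)\<in>set xs. a = 0 \<and> k \<le> 2"
    moreover have "0 < k" if "(k, a) \<in> set xs" for k a
      using that assms(1) by (metis fst_conv gr0I image_eqI)
    ultimately have z: "jordan_block k a ^\<^sub>m 2 = 0\<^sub>m k k" if "(k, a) \<in> set xs" for k a
      using that jordan_block_square_eq_zero_iff by blast
    have "diag_block_mat (map (\<lambda>(k, a). jordan_block k a ^\<^sub>m 2) xs) = 0\<^sub>m n n"
      unfolding n using z by (induction xs) (auto simp: Let_def)
    then show "jordan_matrix xs * jordan_matrix xs = 0\<^sub>m n n" by (simp add: e)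
  qed
qed

section \<open>Jordan type \<open>(2^r, 1^s)\<close> as square zero and rank
  \<open>r\<close>\<close>

text \<open>Here \<open>r\<close> is the rank, read off from the size of the range. The first two
  conditions are inherited when the last row and column are deleted, which makes a recursion on
  \<open>n\<close> possible.\<close>

definition square_zero_mats :: "nat \<Rightarrow> nat \<Rightarrow> 'a :: {field, finite} mat set" where
  "square_zero_mats n r = {A \<in> carrier_mat n n. (\<forall>i<n. \<forall>j\<le>i. A $$ (i, j) = 0) \<and>
    A * A = 0\<^sub>m n n \<and> card (mat_range A) = CARD('a) ^ r}"

lemma CARD_field_ge_2: "2 \<le> CARD('a :: {field, finite})"
proof -
  have "card {0, 1 :: 'a} \<le> CARD('a)" by (rule card_mono) auto
  then show ?thesis by simp
qed

text \<open>Both properties are invariant under similarity and are computed on the Jordan matrix,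
  where each block of size 2 adds 1 to the rank and each block of size 1 adds 0.\<close>

lemma jordan_type_imp_square_zero:
  fixes A :: "'a :: {field, finite} mat"
  assumes "has_jordan_type A (replicate r 2 @ replicate s 1)" "A \<in> carrier_mat n n"
  shows "A * A = 0\<^sub>m n n" "card (mat_range A) = CARD('a) ^ r"
proof -
  let ?ks = "replicate r 2 @ replicate s 1 :: nat list"
  let ?xs = "map (\<lambda>k. (k, 0 :: 'a)) ?ks"
  have sim: "similar_mat A (jordan_matrix ?xs)" and nz: "0 \<notin> fst ` set ?xs"
    using assms(1) unfolding has_jordan_type_def jordan_nf_def by blast+
  have J: "jordan_matrix ?xs \<in> carrier_mat n n"
    using similar_matD[OF sim] assms(2) by auto
  then have n: "n = sum_list (map fst ?xs)"
    using jordan_matrix_dim(1)[of ?xs] by (metis carrier_matD(1))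
  have "jordan_matrix ?xs * jordan_matrix ?xs = 0\<^sub>m n n"
    using jordan_matrix_square_eq_zero_iff[OF nz n] by auto
  then show "A * A = 0\<^sub>m n n" by (rule similar_mat_mult_self_zero[OF sim J])
  have "card (mat_range A) = CARD('a) ^ (\<Sum>k\<leftarrow>?ks. k - 1)"
    unfolding card_mat_range_similar[OF sim] by (rule card_mat_range_jordan_matrix) auto
  also have "(\<Sum>k\<leftarrow>?ks. k - 1) = r" by (simp add: sum_list_replicate)
  finally show "card (mat_range A) = CARD('a) ^ r" .
qed

lemma square_zero_obtains_jordan_type:
  fixes A :: "'a :: {field, finite} mat"
  assumes A: "A \<in> carrier_mat n n" "upper_triangular A"
    and sq: "A * A = 0\<^sub>m n n"
  obtains r s where "n = 2 * r + s" "has_jordan_type A (replicate r 2 @ replicate s 1)"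
proof -
  \<comment> \<open>Triangularity guarantees a Jordan normal form over the given field, although
    that field is not algebraically closed.\<close>
  obtain xs where jnf: "jordan_nf A xs" using triangular_to_jnf_vector[OF A] by blast
  then have sim: "similar_mat A (jordan_matrix xs)" and nz: "0 \<notin> fst ` set xs"
    by (auto simp: jordan_nf_def)
  have J: "jordan_matrix xs \<in> carrier_mat n n"
    using similar_matD[OF sim] A by auto
  then have n: "n = sum_list (map fst xs)"
    using jordan_matrix_dim(1)[of xs] by (metis carrier_matD(1))
  have "jordan_matrix xs * jordan_matrix xs = 0\<^sub>m n n"
    by (rule similar_mat_mult_self_zero[OF similar_mat_sym[OF sim] A(1) sq])
  then have "a = 0 \<and> k \<le> 2" if "(k, a) \<in> set xs" for k a
    using that jordan_matrix_square_eq_zero_iff[OF nz n] by blast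
  then have "\<forall>x\<in>set xs. x = (1, 0) \<or> x = (2, 0)"
    using nz by (force simp: image_iff le_Suc_eq numeral_2_eq_2)
  then obtain r s where m: "mset xs = mset (replicate r (2, 0) @ replicate s (1, 0))"
  proof (induction xs arbitrary: thesis)
    case Nil
    show ?case by (rule Nil(1)[of 0 0]) simp
  next
    case (Cons x xs)
    then obtain r s where rs: "mset xs = mset (replicate r (2, 0) @ replicate s (1, 0))" by auto
    show ?case
    proof (cases "x = (1, 0)")
      case True
      then show ?thesis using rs by (intro Cons.prems(1)[of r "Suc s"]) simp
    next
      case False
      then show ?thesis using rs Cons.prems(2) by (intro Cons.prems(1)[of "Suc r" s]) simp
    qed
  qed
  have "has_jordan_type A (replicate r 2 @ replicate s 1)"
    unfolding has_jordan_type_def using jordan_nf_mset[OF jnf m] by (simp add: map_replicate)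
  \<comment> \<open>The size is the sum of the block sizes, taken over the multiset because the
    order in \<open>xs\<close> is unknown.\<close>
  moreover have "n = 2 * r + s"
  proof -
    have "sum_mset (image_mset fst (mset xs)) = 2 * r + s" unfolding m by simp
    then show ?thesis by (simp add: n flip: sum_mset_sum_list)
  qed
  ultimately show ?thesis using that by blast
qed

lemma ut_nilpotent_jordan_type_eq:
  "{A :: 'a :: {field, finite} mat. A \<in> ut_nilpotent_mats (2 * r + s) \<and>
    has_jordan_type A (replicate r 2 @ replicate s 1)} = square_zero_mats (2 * r + s) r"
proof (intro equalityI subsetI CollectI conjI)
  fix A :: "'a mat"
  assume "A \<in> {A. A \<in> ut_nilpotent_mats (2 * r + s) \<and>
    has_jordan_type A (replicate r 2 @ replicate s 1)}"
  then have A: "A \<in> ut_nilpotent_mats (2 * r + s)" "has_jordan_type A (replicate r 2 @ replicate s 1)"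
    by auto
  then have c: "A \<in> carrier_mat (2 * r + s) (2 * r + s)" by (simp add: ut_nilpotent_mats_def)
  show "A \<in> square_zero_mats (2 * r + s) r"
    using jordan_type_imp_square_zero[OF A(2) c] ut_nilpotent_imp_strict[OF A(1)] c
    by (simp add: square_zero_mats_def)
next
  fix A :: "'a mat"
  let ?n = "2 * r + s"
  assume "A \<in> square_zero_mats ?n r"
  then have A: "A \<in> carrier_mat ?n ?n" "upper_triangular A" and sq: "A * A = 0\<^sub>m ?n ?n"
    and card: "card (mat_range A) = CARD('a) ^ r"
    by (auto simp: square_zero_mats_def)
  have "A ^\<^sub>m 2 = 0\<^sub>m (dim_row A) (dim_row A)" using A sq by (simp add: numeral_2_eq_2)
  then show "A \<in> ut_nilpotent_mats ?n"
    using A by (auto simp: ut_nilpotent_mats_def nilpotent_mat_def)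
  obtain r' s' where n: "?n = 2 * r' + s'" and jt: "has_jordan_type A (replicate r' 2 @ replicate s' 1)"
    using square_zero_obtains_jordan_type[OF A sq] .
  \<comment> \<open>The rank, computed from the Jordan type found for \<open>A\<close>, identifies
    \<open>r'\<close>; the matrix size then identifies \<open>s'\<close>.\<close>
  have "CARD('a) ^ r' = CARD('a) ^ r"
    using jordan_type_imp_square_zero(2)[OF jt A(1)] card by simp
  then have "r' = r" using CARD_field_ge_2[where ?'a = 'a] by (simp add: power_inject_exp)
  with n jt show "has_jordan_type A (replicate r 2 @ replicate s 1)" by simp
qed

subsection \<open>Adding a column\<close>

definition add_col :: "'a :: zero mat \<Rightarrow> 'a vec \<Rightarrow> 'a mat" where
  "add_col B v = four_block_mat B (mat_of_cols (dim_row B) [v]) (0\<^sub>m 1 (dim_col B)) (0\<^sub>m 1 1)"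

lemma add_col_carrier: "B \<in> carrier_mat n n \<Longrightarrow> add_col B v \<in> carrier_mat (Suc n) (Suc n)"
  by (rule carrier_matI) (simp_all add: add_col_def)

lemma add_col_index:
  assumes "B \<in> carrier_mat n n" "v \<in> carrier_vec n" "i \<le> n" "j \<le> n"
  shows "add_col B v $$ (i, j) = (if i < n then if j < n then B $$ (i, j) else v $ i else 0)"
  using assms by (auto simp: add_col_def mat_of_cols_def)

lemma add_col_inject:
  assumes "B \<in> carrier_mat n n" "v \<in> carrier_vec n" "B' \<in> carrier_mat n n" "v' \<in> carrier_vec n"
    and eq: "add_col B v = add_col B' v'"
  shows "B = B' \<and> v = v'"
proof
  show "B = B'"
  proof (rule eq_matI)
    fix i j assume "i < dim_row B'" "j < dim_col B'"
    then show "B $$ (i, j) = B' $$ (i, j)"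
      using arg_cong[OF eq, of "\<lambda>M. M $$ (i, j)"] assms(1-4) by (simp add: add_col_index[of _ n])
  qed (use assms in auto)
  show "v = v'"
  proof (rule eq_vecI)
    fix i assume "i < dim_vec v'"
    then show "v $ i = v' $ i"
      using arg_cong[OF eq, of "\<lambda>M. M $$ (i, n)"] assms(1-4) by (simp add: add_col_index[of _ n])
  qed (use assms in auto)
qed

lemma strict_upper_eq_add_col:
  fixes A :: "'a :: zero mat"
  assumes A: "A \<in> carrier_mat (Suc n) (Suc n)" and z: "\<forall>i<Suc n. \<forall>j\<le>i. A $$ (i, j) = 0"
  obtains B v where "B \<in> carrier_mat n n" "v \<in> carrier_vec n" "A = add_col B v"
proof
  let ?B = "mat n n (\<lambda>ij. A $$ ij)" and ?v = "vec n (\<lambda>i. A $$ (i, n))"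
  show "?B \<in> carrier_mat n n" "?v \<in> carrier_vec n" by auto
  show "A = add_col ?B ?v"
  proof (rule eq_matI)
    fix i j assume "i < dim_row (add_col ?B ?v)" "j < dim_col (add_col ?B ?v)"
    then have "i \<le> n" "j \<le> n" by (auto simp: add_col_def)
    then show "A $$ (i, j) = add_col ?B ?v $$ (i, j)"
      using z by (subst add_col_index) (auto simp: le_less)
  qed (use A in \<open>auto simp: add_col_def\<close>)
qed

lemma add_col_strict_upper_iff:
  assumes "B \<in> carrier_mat n n" "v \<in> carrier_vec n"
  shows "(\<forall>i<Suc n. \<forall>j\<le>i. add_col B v $$ (i, j) = 0) \<longleftrightarrow> (\<forall>i<n. \<forall>j\<le>i. B $$ (i, j) = 0)"
  unfolding less_Suc_eq_le using assms by (auto simp: add_col_index[of B n v])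

text \<open>Squaring preserves the shape: the square of \<open>add_col B v\<close> is
  \<open>add_col (B * B) (B *\<^sub>v v)\<close>, and its two parts can be compared with zero
  separately.\<close>

lemma add_col_square_zero_iff:
  fixes B :: "'a :: field mat"
  assumes B: "B \<in> carrier_mat n n" and v: "v \<in> carrier_vec n"
  shows "add_col B v * add_col B v = 0\<^sub>m (Suc n) (Suc n) \<longleftrightarrow>
    B * B = 0\<^sub>m n n \<and> v \<in> mat_kernel B"
proof -
  let ?V = "mat_of_cols n [v]"
  have V: "?V \<in> carrier_mat n 1" by (rule carrier_matI) simp_all
  have e: "add_col B v * add_col B v = add_col (B * B) (B *\<^sub>v v)"
  proof -
    have "vec n (($) v) = v" using v by (intro eq_vecI) auto
    then have "B * ?V = mat_of_cols n [B *\<^sub>v v]"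
      using B V v by (intro eq_matI) (auto simp: col_mult2 mat_of_cols_def)
    moreover have "add_col B v * add_col B v =
      four_block_mat (B * B + ?V * 0\<^sub>m 1 n) (B * ?V + ?V * 0\<^sub>m 1 1)
        (0\<^sub>m 1 n * B + 0\<^sub>m 1 1 * 0\<^sub>m 1 n) (0\<^sub>m 1 n * ?V + 0\<^sub>m 1 1 * 0\<^sub>m 1 1)"
      using B V unfolding add_col_def by (subst mult_four_block_mat[of _ n n _ 1 _ 1]) auto
    moreover have "mat_of_cols n [B *\<^sub>v v] + 0\<^sub>m n 1 = mat_of_cols n [B *\<^sub>v v]"
      by (rule right_add_zero_mat) (rule carrier_matI; simp)
    ultimately show ?thesis using B V by (simp add: add_col_def)
  qed
  \<comment> \<open>With zero written in the same shape, injectivity of \<open>add_col\<close>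
    applies.\<close>
  have z: "0\<^sub>m (Suc n) (Suc n) = add_col (0\<^sub>m n n) (0\<^sub>v n :: 'a vec)"
    by (intro eq_matI) (auto simp: add_col_def mat_of_cols_def)
  have "add_col (B * B) (B *\<^sub>v v) = add_col (0\<^sub>m n n) (0\<^sub>v n) \<longleftrightarrow>
    B * B = 0\<^sub>m n n \<and> B *\<^sub>v v = 0\<^sub>v n"
    using add_col_inject[of "B * B" n "B *\<^sub>v v" "0\<^sub>m n n" "0\<^sub>v n"] B v by auto
  then show ?thesis using v by (simp add: e z mat_kernel[OF B])
qed

text \<open>Up to a final coordinate 0, the new range \<open>?R\<close> is the sum of the range of
  \<open>B\<close> and the line spanned by \<open>v\<close>. It equals the old range if
  \<open>v\<close> lies in it; otherwise the representation \<open>y + c v\<close> is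
  unique.\<close>

lemma card_mat_range_add_col:
  fixes B :: "'a :: {field, finite} mat"
  assumes B: "B \<in> carrier_mat n n" and v: "v \<in> carrier_vec n"
  shows "card (mat_range (add_col B v)) =
    (if v \<in> mat_range B then 1 else CARD('a)) * card (mat_range B)"
proof -
  let ?R = "(\<lambda>(y, c). y + c \<cdot>\<^sub>v v) ` (mat_range B \<times> UNIV)"
  let ?V = "mat_of_cols n [v]"
  have V: "?V \<in> carrier_mat n 1" by (rule carrier_matI) simp_all
  have Vd: "?V *\<^sub>v d = d $ 0 \<cdot>\<^sub>v v" if "d \<in> carrier_vec 1" for d
    using that v by (intro eq_vecI) (auto simp: scalar_prod_def mat_of_cols_def mult.commute)
  have mult: "add_col B v *\<^sub>v (a @\<^sub>v d) = (B *\<^sub>v a + d $ 0 \<cdot>\<^sub>v v) @\<^sub>v 0\<^sub>v 1"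
    if "a \<in> carrier_vec n" "d \<in> carrier_vec 1" for a d
    unfolding add_col_def using B V that
    by (subst four_block_mat_mult_vec[of _ n n _ 1 _ 1]) (auto simp: Vd)
  have dim: "dim_col (add_col B v) = n + 1" using B by (simp add: add_col_def)
  have R: "mat_range B \<subseteq> carrier_vec n" by (rule mat_range_subset_carrier[OF B])
  have "mat_range (add_col B v) = (\<lambda>y. y @\<^sub>v 0\<^sub>v 1) ` ?R"
  proof (intro equalityI subsetI)
    fix y assume "y \<in> mat_range (add_col B v)"
    then obtain w where w: "w \<in> carrier_vec (n + 1)" "y = add_col B v *\<^sub>v w"
      unfolding mat_range_def dim by auto
    then have "y = (B *\<^sub>v vec_first w n + vec_last w 1 $ 0 \<cdot>\<^sub>v v) @\<^sub>v 0\<^sub>v 1"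
      using mult[of "vec_first w n" "vec_last w 1"] by simp
    moreover have "B *\<^sub>v vec_first w n \<in> mat_range B" using B by (auto simp: mat_range_def)
    ultimately show "y \<in> (\<lambda>y. y @\<^sub>v 0\<^sub>v 1) ` ?R" by (force simp: image_iff)
  next
    fix y assume "y \<in> (\<lambda>y. y @\<^sub>v 0\<^sub>v 1) ` ?R"
    then obtain a c where a: "a \<in> carrier_vec n" "y = (B *\<^sub>v a + c \<cdot>\<^sub>v v) @\<^sub>v 0\<^sub>v 1"
      using B by (auto simp: mat_range_def)
    then have "y = add_col B v *\<^sub>v (a @\<^sub>v vec 1 (\<lambda>_. c))" using mult[of a "vec 1 (\<lambda>_. c)"] by simp
    moreover have "a @\<^sub>v vec 1 (\<lambda>_. c) \<in> carrier_vec (n + 1)" using a by (intro carrier_vecI) simp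
    ultimately show "y \<in> mat_range (add_col B v)" unfolding mat_range_def dim by blast
  qed
  moreover have "inj_on (\<lambda>y. y @\<^sub>v 0\<^sub>v 1) ?R"
  proof (rule inj_on_subset)
    show "inj_on (\<lambda>y. y @\<^sub>v 0\<^sub>v 1) (carrier_vec n :: 'a vec set)"
      by (auto simp: inj_on_def append_vec_eq[of _ n])
    show "?R \<subseteq> carrier_vec n" using R v by auto
  qed
  ultimately have card: "card (mat_range (add_col B v)) = card ?R" by (simp add: card_image)
  show ?thesis
  proof (cases "v \<in> mat_range B")
    case True
    then obtain w where w: "w \<in> carrier_vec n" "v = B *\<^sub>v w" using B by (auto simp: mat_range_def)
    have "?R = mat_range B"
    proof (intro equalityI subsetI)
      fix y assume "y \<in> ?R"
      then obtain a c where a: "a \<in> carrier_vec n" "y = B *\<^sub>v a + c \<cdot>\<^sub>v v"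
        using B by (auto simp: mat_range_def)
      then have "y = B *\<^sub>v (a + c \<cdot>\<^sub>v w)"
        using w B by (simp add: mult_add_distrib_mat_vec[OF B] mult_mat_vec[OF B])
      then show "y \<in> mat_range B" using a w B by (auto simp: mat_range_def)
    next
      fix y assume y: "y \<in> mat_range B"
      then have "y = y + 0 \<cdot>\<^sub>v v" using R v by (intro eq_vecI) auto
      with y show "y \<in> ?R" by (intro image_eqI[of _ _ "(y, 0)"]) auto
    qed
    with True card show ?thesis by simp
  next
    case False
    have "inj_on (\<lambda>(y, c). y + c \<cdot>\<^sub>v v) (mat_range B \<times> UNIV)"
    proof (rule inj_onI, clarsimp)
      fix y c y' c'
      assume y: "y \<in> mat_range B" "y' \<in> mat_range B" and eq: "y + c \<cdot>\<^sub>v v = y' + c' \<cdot>\<^sub>v v"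
      have yc: "y \<in> carrier_vec n" "y' \<in> carrier_vec n" using y R by auto
      obtain a a' where a: "a \<in> carrier_vec n" "y = B *\<^sub>v a" "a' \<in> carrier_vec n" "y' = B *\<^sub>v a'"
        using y B by (auto simp: mat_range_def)
      have i: "y $ i + c * v $ i = y' $ i + c' * v $ i" if "i < n" for i
        using arg_cong[OF eq, of "\<lambda>w. w $ i"] that v yc by simp
      have "c = c'"
      proof (rule ccontr)
        assume "c \<noteq> c'"
        \<comment> \<open>Two representations with distinct coefficients can be solved for
          \<open>v\<close>, which puts \<open>v\<close> into the range of \<open>B\<close>.\<close>
        have "v = inverse (c - c') \<cdot>\<^sub>v (y' - y)"
        proof (rule eq_vecI)
          fix j assume "j < dim_vec (inverse (c - c') \<cdot>\<^sub>v (y' - y))"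
          then have "j < n" using yc by simp
          then have "(c - c') * v $ j = y' $ j - y $ j" using i[of j] by (simp add: algebra_simps)
          then show "v $ j = (inverse (c - c') \<cdot>\<^sub>v (y' - y)) $ j"
            using \<open>c \<noteq> c'\<close> \<open>j < n\<close> yc by (simp add: field_simps)
        qed (use v yc in simp)
        also have "\<dots> = B *\<^sub>v (inverse (c - c') \<cdot>\<^sub>v (a' - a))"
          using a by (simp add: mult_mat_vec[OF B] mult_minus_distrib_mat_vec[OF B])
        finally have "v \<in> mat_range B" using a B by (auto simp: mat_range_def)
        with False show False by simp
      qed
      moreover from this have "y = y'" using i yc by (intro eq_vecI) auto
      ultimately show "y = y' \<and> c = c'" by simp
    qed
    then show ?thesis using False card by (simp add: card_image card_cartesian_product)
  qed
qed

section \<open>Counting square-zero matrices by size and rank\<close>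

text \<open>A column in the range keeps the rank and lies in the kernel automatically when
  \<open>B\<close> squares to zero; a column of the kernel outside the range raises the rank by
  one.\<close>

lemma add_col_mem_square_zero_mats_iff:
  fixes B :: "'a :: {field, finite} mat"
  assumes B: "B \<in> carrier_mat n n" and v: "v \<in> carrier_vec n"
  shows "add_col B v \<in> square_zero_mats (Suc n) r \<longleftrightarrow>
    B \<in> square_zero_mats n r \<and> v \<in> mat_range B \<or>
    (\<exists>r'. r = Suc r' \<and> B \<in> square_zero_mats n r' \<and> v \<in> mat_kernel B - mat_range B)"
proof -
  have q: "2 \<le> CARD('a)" by (rule CARD_field_ge_2)
  \<comment> \<open>For \<open>r = 0\<close> the left side would make 1 a multiple of a number that
    is at least 2.\<close>
  have r: "CARD('a) * c = CARD('a) ^ r \<longleftrightarrow> (\<exists>r'. r = Suc r' \<and> c = CARD('a) ^ r')" for c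
    using q by (cases r) auto
  have "v \<in> mat_kernel B" if "v \<in> mat_range B" "B * B = 0\<^sub>m n n"
    using that mat_range_subset_mat_kernel[OF B] by auto
  then show ?thesis
    unfolding square_zero_mats_def mem_Collect_eq
      add_col_strict_upper_iff[OF assms] add_col_square_zero_iff[OF assms]
      card_mat_range_add_col[OF assms]
    using B add_col_carrier[OF B] r by (cases "v \<in> mat_range B") auto
qed

text \<open>The index set \<open>{r'. r = Suc r'}\<close> is empty for \<open>r = 0\<close> and a
  singleton otherwise, so one formula serves both rank zero and positive rank.\<close>

lemma square_zero_mats_Suc:
  "square_zero_mats (Suc n) r = (\<lambda>(B, v). add_col B v) `
    ((SIGMA B:square_zero_mats n r. mat_range B) \<union>
     (\<Union>r'\<in>{r'. r = Suc r'}. SIGMA B:square_zero_mats n r'. mat_kernel B - mat_range B))"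
  (is "_ = _ ` ?S")
proof (intro equalityI subsetI)
  fix A :: "'a mat" assume A: "A \<in> square_zero_mats (Suc n) r"
  then obtain B v where Bv: "B \<in> carrier_mat n n" "v \<in> carrier_vec n" "A = add_col B v"
    using strict_upper_eq_add_col[of A n] by (auto simp: square_zero_mats_def)
  with A have "(B, v) \<in> ?S" by (auto simp: add_col_mem_square_zero_mats_iff)
  with Bv show "A \<in> (\<lambda>(B, v). add_col B v) ` ?S" by (intro image_eqI[of _ _ "(B, v)"]) auto
next
  fix A :: "'a mat" assume "A \<in> (\<lambda>(B, v). add_col B v) ` ?S"
  then obtain B v where Bv: "(B, v) \<in> ?S" "A = add_col B v" by auto
  then have B: "B \<in> carrier_mat n n" by (auto simp: square_zero_mats_def)
  have "v \<in> carrier_vec n"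
    using Bv mat_range_subset_carrier[OF B] by (auto simp: mat_kernel[OF B])
  with Bv B show "A \<in> square_zero_mats (Suc n) r" by (auto simp: add_col_mem_square_zero_mats_iff)
qed

lemma finite_square_zero_mats: "finite (square_zero_mats n r)"
  by (rule finite_subset[OF _ finite_carrier_mat[of n n]]) (auto simp: square_zero_mats_def)

text \<open>Rank-nullity gives the kernel \<open>q ^ (n - r)\<close> elements with
  \<open>q = CARD('a)\<close>. As the kernel contains the range, \<open>2 * r \<le> n\<close>, so
  neither subtraction truncates.\<close>

lemma card_mat_kernel_diff_mat_range:
  assumes "B \<in> square_zero_mats n r"
  shows "2 * r \<le> n"
    "card (mat_kernel B - mat_range B) = CARD('a :: {field, finite}) ^ (n - r) - CARD('a) ^ r"
    "finite (mat_kernel (B :: 'a mat))"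
proof -
  have B: "B \<in> carrier_mat n n" and sub: "mat_range B \<subseteq> mat_kernel B"
    and card: "card (mat_range B) = CARD('a) ^ r"
    using assms mat_range_subset_mat_kernel[of B n] by (auto simp: square_zero_mats_def)
  have q: "2 \<le> CARD('a)" by (rule CARD_field_ge_2)
  show fin: "finite (mat_kernel B)"
    by (rule finite_subset[OF _ finite_carrier_vec[of n]]) (auto simp: mat_kernel[OF B])
  have prod: "CARD('a) ^ r * card (mat_kernel B) = CARD('a) ^ n"
    using card_mat_range_mult_card_mat_kernel[OF B] by (simp add: card)
  have "CARD('a) ^ (2 * r) \<le> CARD('a) ^ n"
    unfolding prod[symmetric] mult_2 power_add using card_mono[OF fin sub]
    by (simp add: card)
  then show r: "2 * r \<le> n" using q by (simp add: power_le_imp_le_exp)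
  have "CARD('a) ^ r * card (mat_kernel B) = CARD('a) ^ r * CARD('a) ^ (n - r)"
    unfolding prod using r by (simp flip: power_add)
  then have "card (mat_kernel B) = CARD('a) ^ (n - r)" using q by simp
  then show "card (mat_kernel B - mat_range B) = CARD('a) ^ (n - r) - CARD('a) ^ r"
    using sub by (simp add: card_Diff_subset finite_mat_range card)
qed

lemma square_zero_mats_eq_empty: "n < 2 * r \<Longrightarrow> square_zero_mats n r = {}"
  using card_mat_kernel_diff_mat_range(1) by (metis all_not_in_conv not_le)

lemma inj_on_add_col:
  assumes "S \<subseteq> carrier_mat n n \<times> carrier_vec n"
  shows "inj_on (\<lambda>(B, v). add_col B v) S"
proof (rule inj_onI, clarify)
  fix B v B' v'
  assume "(B, v) \<in> S" "(B', v') \<in> S" "add_col B v = add_col B' v'"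
  with assms show "B = B' \<and> v = v'" by (intro add_col_inject[of B n]) auto
qed

lemma Sigma_mat_kernel_subset:
  "(SIGMA B:(square_zero_mats n r :: 'a :: {field, finite} mat set). mat_kernel B)
    \<subseteq> carrier_mat n n \<times> carrier_vec n"
proof clarify
  fix B :: "'a mat" and v
  assume "B \<in> square_zero_mats n r" "v \<in> mat_kernel B"
  then show "B \<in> carrier_mat n n \<and> v \<in> carrier_vec n"
    using mat_kernel[of B n n] by (simp add: square_zero_mats_def)
qed

lemma Sigma_mat_range_subset:
  "(SIGMA B:(square_zero_mats n r :: 'a :: {field, finite} mat set). mat_range B)
    \<subseteq> carrier_mat n n \<times> carrier_vec n"
proof clarify
  fix B :: "'a mat" and v
  assume "B \<in> square_zero_mats n r" "v \<in> mat_range B"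
  then show "B \<in> carrier_mat n n \<and> v \<in> carrier_vec n"
    using mat_range_subset_carrier[of B n n] by (auto simp: square_zero_mats_def)
qed

text \<open>At rank 0 the range is a single vector, so each matrix extends in exactly one
  way.\<close>

lemma card_square_zero_mats_0:
  "card (square_zero_mats n 0 :: 'a :: {field, finite} mat set) = 1"
proof (induction n)
  case 0
  have "square_zero_mats 0 0 = {0\<^sub>m 0 0 :: 'a mat}"
  proof -
    have "mat_range (0\<^sub>m 0 0 :: 'a mat) = {0\<^sub>v 0}"
      by (auto simp: mat_range_def intro!: image_eqI[of _ _ "0\<^sub>v 0"])
    then show ?thesis by (auto simp: square_zero_mats_def)
  qed
  then show ?case by simp
next
  case (Suc n)
  have "card (square_zero_mats (Suc n) 0 :: 'a mat set) =
    card (SIGMA B:square_zero_mats n 0 :: 'a mat set. mat_range B)"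
    unfolding square_zero_mats_Suc
    by (subst card_image[OF inj_on_add_col[of _ n]]) (use Sigma_mat_range_subset in auto)
  also have "\<dots> = (\<Sum>B\<in>(square_zero_mats n 0 :: 'a mat set). card (mat_range B))"
    by (simp add: finite_square_zero_mats finite_mat_range)
  also have "\<dots> = card (square_zero_mats n 0 :: 'a mat set)" by (simp add: square_zero_mats_def)
  finally show ?case using Suc by simp
qed

text \<open>The summands count the extensions that keep the rank and those that raise it. The
  difference can truncate only for \<open>n < 2 * r\<close>, where the factor after it is 0.\<close>

lemma card_square_zero_mats_Suc:
  "card (square_zero_mats (Suc n) (Suc r) :: 'a :: {field, finite} mat set) =
    CARD('a) ^ Suc r * card (square_zero_mats n (Suc r) :: 'a mat set) +
    (CARD('a) ^ (n - r) - CARD('a) ^ r) * card (square_zero_mats n r :: 'a mat set)"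
proof -
  let ?S = "SIGMA B:(square_zero_mats n (Suc r) :: 'a mat set). mat_range B"
  let ?T = "SIGMA B:(square_zero_mats n r :: 'a mat set). mat_kernel B - mat_range B"
  have sub: "?S \<union> ?T \<subseteq> carrier_mat n n \<times> carrier_vec n"
    using Sigma_mat_range_subset[of n "Suc r", where ?'a = 'a]
      Sigma_mat_kernel_subset[of n r, where ?'a = 'a] by blast
  have "card (square_zero_mats (Suc n) (Suc r) :: 'a mat set) = card (?S \<union> ?T)"
    unfolding square_zero_mats_Suc by (simp add: card_image[OF inj_on_add_col[OF sub]])
  also have "\<dots> = card ?S + card ?T"
  proof (rule card_Un_disjoint)
    show "finite ?S" "finite ?T"
      by (auto simp: finite_square_zero_mats finite_mat_range card_mat_kernel_diff_mat_range(3)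
          intro!: finite_SigmaI)
  qed auto
  also have "card ?S = CARD('a) ^ Suc r * card (square_zero_mats n (Suc r) :: 'a mat set)"
  proof -
    have "card ?S = (\<Sum>B\<in>(square_zero_mats n (Suc r) :: 'a mat set). card (mat_range B))"
      by (simp add: finite_square_zero_mats finite_mat_range)
    then show ?thesis by (simp add: square_zero_mats_def)
  qed
  also have "card ?T = (CARD('a) ^ (n - r) - CARD('a) ^ r) * card (square_zero_mats n r :: 'a mat set)"
  proof -
    have "card ?T = (\<Sum>B\<in>(square_zero_mats n r :: 'a mat set). card (mat_kernel B - mat_range B))"
      by (simp add: finite_square_zero_mats card_mat_kernel_diff_mat_range(3))
    then show ?thesis by (simp add: card_mat_kernel_diff_mat_range(2))
  qed
  finally show ?thesis .
qed

lemma card_square_zero_mats: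
  fixes q :: int
  assumes q: "q = int CARD('a)"
  shows "int (card (square_zero_mats (2 * r + s) r :: 'a :: {field, finite} mat set)) =
    (q - 1) ^ r * q ^ (r choose 2) * dyck_sum q (r + s) r"
proof (induction "2 * r + s" arbitrary: r s)
  case 0
  then show ?case by (simp add: card_square_zero_mats_0 dyck_sum_0 numeral_2_eq_2)
next
  case (Suc n)
  show ?case
  proof (cases r)
    case 0
    then show ?thesis by (simp add: card_square_zero_mats_0 dyck_sum_0 numeral_2_eq_2)
  next
    case r: (Suc t)
    \<comment> \<open>Deleting a column that raised the rank turns one part 2 into a part 1, so
      \<open>s\<close> grows while the size drops.\<close>
    have n: "n = 2 * t + Suc s" using Suc.hyps(2) r by simp
    let ?N = "\<lambda>n r. int (card (square_zero_mats n r :: 'a mat set))"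
    have IH1: "?N n t = (q - 1) ^ t * q ^ (t choose 2) * dyck_sum q (Suc (t + s)) t"
      using Suc.hyps(1)[OF n] n by simp
    \<comment> \<open>Deleting a column that kept the rank removes a part 1. For
      \<open>s = 0\<close> there is none: size \<open>2 * t + 1\<close> is too small for rank
      \<open>Suc t\<close>, and no Dyck path ends above the diagonal, so both sides vanish.\<close>
    have IH2: "?N n (Suc t) = (q - 1) ^ Suc t * q ^ (Suc t choose 2) * dyck_sum q (t + s) (Suc t)"
    proof (cases s)
      case 0
      then show ?thesis by (simp add: n square_zero_mats_eq_empty dyck_sum_eq_0)
    next
      case (Suc u)
      then show ?thesis using Suc.hyps(1)[of "Suc t" u] n by simp
    qed
    have "CARD('a) ^ t \<le> CARD('a) ^ (n - t)"
      using CARD_field_ge_2[where ?'a = 'a] n by (intro power_increasing) auto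
    then have "?N (Suc n) (Suc t) = q ^ Suc t * ?N n (Suc t) + (q ^ (n - t) - q ^ t) * ?N n t"
      by (simp add: card_square_zero_mats_Suc q of_nat_diff)
    \<comment> \<open>Here \<open>n - t = t + Suc s\<close>; factoring out \<open>q ^ t\<close>
      leaves \<open>q ^ Suc s - 1\<close>.\<close>
    also have "q ^ (n - t) - q ^ t = q ^ t * ((q - 1) * q_number q (Suc s))"
      by (simp only: q_minus_1_times_q_number) (simp add: n algebra_simps flip: power_add)
    \<comment> \<open>The factors \<open>q ^ t\<close> and \<open>q - 1\<close> of the second
      summand are absorbed into the prefactor, because \<open>Suc t choose 2\<close> is
      \<open>t + (t choose 2)\<close>. What remains in parentheses is the Dyck path
      recurrence.\<close>
    also have "q ^ Suc t * ?N n (Suc t) + q ^ t * ((q - 1) * q_number q (Suc s)) * ?N n t =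
      (q - 1) ^ Suc t * q ^ (Suc t choose 2) *
        (q ^ Suc t * dyck_sum q (t + s) (Suc t) + q_number q (Suc s) * dyck_sum q (Suc (t + s)) t)"
      unfolding IH1 IH2 by (simp add: numeral_2_eq_2 power_add algebra_simps)
    also have "\<dots> = (q - 1) ^ Suc t * q ^ (Suc t choose 2) * dyck_sum q (Suc (t + s)) (Suc t)"
      by (simp add: dyck_sum_Suc_Suc Suc_diff_le)
    finally show ?thesis using Suc.hyps(2) by (simp add: r)
  qed
qed

theorem proposition2p19:
  fixes q r s :: nat
  assumes "q = CARD('a)"
  shows "int (F_count TYPE('a :: {field, finite}) (replicate r 2 @ replicate s 1)) =
    (int q - 1) ^ r * int q ^ (r choose 2) *
      (\<Sum>p\<in>dyck (r + s) r. int q ^ coarea p * (\<Prod>i=1..r. q_number (int q) (rho p i)))"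
proof -
  have "sum_list (replicate r 2 @ replicate s 1) = 2 * r + s"
    by (simp add: sum_list_replicate)
  then have "F_count TYPE('a) (replicate r 2 @ replicate s 1) =
    card (square_zero_mats (2 * r + s) r :: 'a mat set)"
    by (simp only: F_count_def ut_nilpotent_jordan_type_eq)
  then show ?thesis
    using card_square_zero_mats[where ?'a = 'a, of "int q" r s] assms by (simp add: dyck_sum_def)
qed

end
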